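(* For every $k\in\{1,2,3\}$ and every positive rational number $r$, $$\genfrac{[}{]}{0pt}{}{1/2+k}{k}_q \;\geq_q\; \genfrac{[}{]}{0pt}{}{r+k}{k}_q .$$
   Context: Let $\mathcal P=\bigcup_{b\ge 1}\mathbb{Q}[[q^{1/b}]]$ be the ring of Puiseux series over $\mathbb{Q}$ with nonnegative exponents (formal series in $q$ whose exponents are nonnegative rationals admitting a common denominator). For $A(q)=\sum_{\alpha\in\mathbb{Q}_{\ge 0}}a_\alpha q^\alpha\in\mathcal P$, the integer trace is $\operatorname{Tr}_{\mathbb Z}A(q):=\sum_{d\in\mathbb{Z}_{\ge 0}}a_d q^d\in\mathbb{Q}[[q]]$, i.e. all terms with nonintegral exponent are discarded. For $F,G\in\mathcal P$, write $F\geq_q G$ if and only if every coefficient of $\operatorname{Tr}_{\mathbb Z}(F-G)$ is nonnegative. For an integer $k\ge 0$ and a positive rational $r$, the generalized Gaussian binomial coefficient is the element of $\mathcal P$ $$\genfrac{[}{]}{0pt}{}{r+k}{k}_q=\frac{(1-q^{r+1})(1-q^{r+2})\cdots(1-q^{r+k})}{(1-q)(1-q^2)\cdots(1-q^k)}.$$ *)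

theory Defs
  imports "HOL-Computational_Algebra.Formal_Power_Series"
begin

section \<open>Puiseux series over the rationals with nonnegative exponents\<close>

text \<open>
  The series with coefficient $f(\alpha)$ at $q^\alpha$ is represented by its coefficient function
  \<open>f\<close>; the support has to lie in $\frac1b\mathbb{N}$ for some positive integer \<open>b\<close>.
\<close>

typedef puiseux =
  "{f :: rat \<Rightarrow> rat. \<exists>b::nat. b > 0 \<and> (\<forall>\<alpha>. f \<alpha> \<noteq> 0 \<longrightarrow> (\<exists>n::nat. \<alpha> = of_nat n / of_nat b))}"
  morphisms puiseux_coeff Abs_puiseux
  by (rule exI[of _ "\<lambda>_. 0"]) auto

setup_lifting type_definition_puiseux

lemma puiseux_eqI: "(\<And>\<alpha>. puiseux_coeff f \<alpha> = puiseux_coeff g \<alpha>) \<Longrightarrow> f = g"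
  by (metis ext puiseux_coeff_inject)

text \<open>
  For \<open>b > 0\<close>, \<open>puiseux_of_fps b F\<close> is the series $F(q^{1/b})$.  It serves only in
  proofs, to carry facts about formal power series over to Puiseux series.
\<close>

lift_definition puiseux_of_fps :: "nat \<Rightarrow> rat fps \<Rightarrow> puiseux" is
  "\<lambda>b F \<alpha>. if b > 0 \<and> (\<exists>n::nat. \<alpha> = of_nat n / of_nat b)
            then fps_nth F (nat \<lfloor>\<alpha> * of_nat b\<rfloor>) else 0"
  subgoal for b F by (rule exI[of _ "if b > 0 then b else 1"]) auto
  done

lemma coeff_puiseux_of_fps:
  "b > 0 \<Longrightarrow> puiseux_coeff (puiseux_of_fps b F) (of_nat n / of_nat b) = fps_nth F n"
  by transfer auto

lemma coeff_puiseux_of_fps_eq_0: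
  "\<nexists>n::nat. \<alpha> = of_nat n / of_nat b \<Longrightarrow> puiseux_coeff (puiseux_of_fps b F) \<alpha> = 0"
  by transfer auto

lemma coeff_puiseux_of_fps_nonzeroD:
  "puiseux_coeff (puiseux_of_fps b F) \<alpha> \<noteq> 0 \<Longrightarrow> \<exists>n::nat. \<alpha> = of_nat n / of_nat b"
  using coeff_puiseux_of_fps_eq_0 by blast

lemma puiseux_of_fps_eqI:
  assumes "b > 0"
    and "\<And>n::nat. puiseux_coeff f (of_nat n / of_nat b) = fps_nth F n"
    and "\<And>\<alpha>. \<nexists>n::nat. \<alpha> = of_nat n / of_nat b \<Longrightarrow> puiseux_coeff f \<alpha> = 0"
  shows "f = puiseux_of_fps b F"
proof (rule puiseux_eqI)
  fix \<alpha>
  show "puiseux_coeff f \<alpha> = puiseux_coeff (puiseux_of_fps b F) \<alpha>"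
    using assms coeff_puiseux_of_fps[of b F] coeff_puiseux_of_fps_eq_0[of \<alpha> b F]
    by (cases "\<exists>n::nat. \<alpha> = of_nat n / of_nat b") auto
qed

lemma puiseux_denominator_ex:
  "\<exists>b::nat. b > 0 \<and> (\<forall>\<alpha>. puiseux_coeff f \<alpha> \<noteq> 0 \<longrightarrow> (\<exists>n::nat. \<alpha> = of_nat n / of_nat b))"
  by transfer auto

lemma nat_frac_mult_denominator:
  assumes "(\<alpha>::rat) = of_nat n / of_nat b" "b > 0" "c > 0"
  shows "\<exists>m::nat. \<alpha> = of_nat m / of_nat (b * c)" "\<exists>m::nat. \<alpha> = of_nat m / of_nat (c * b)"
  using assms by (auto intro!: exI[of _ "n * c"] simp: field_simps)

lemma puiseux_denominatorE:
  assumes "b > 0"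
    and "\<And>\<alpha>. puiseux_coeff f \<alpha> \<noteq> 0 \<Longrightarrow> \<exists>n::nat. \<alpha> = of_nat n / of_nat b"
  obtains F where "f = puiseux_of_fps b F"
proof
  show "f = puiseux_of_fps b (Abs_fps (\<lambda>n. puiseux_coeff f (of_nat n / of_nat b)))"
    using assms by (intro puiseux_of_fps_eqI) auto
qed

lemma puiseux_common3:
  obtains b F G H where "b > 0"
    "f = puiseux_of_fps b F" "g = puiseux_of_fps b G" "h = puiseux_of_fps b H"
proof -
  obtain b1 b2 b3 :: nat where b: "b1 > 0" "b2 > 0" "b3 > 0"
    and 1: "\<And>\<alpha>. puiseux_coeff f \<alpha> \<noteq> 0 \<Longrightarrow> \<exists>n::nat. \<alpha> = of_nat n / of_nat b1"
    and 2: "\<And>\<alpha>. puiseux_coeff g \<alpha> \<noteq> 0 \<Longrightarrow> \<exists>n::nat. \<alpha> = of_nat n / of_nat b2"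
    and 3: "\<And>\<alpha>. puiseux_coeff h \<alpha> \<noteq> 0 \<Longrightarrow> \<exists>n::nat. \<alpha> = of_nat n / of_nat b3"
    using puiseux_denominator_ex[of f] puiseux_denominator_ex[of g] puiseux_denominator_ex[of h]
    by blast
  define B where "B = b1 * (b2 * b3)"
  have B: "B > 0" using b by (simp add: B_def)
  have B2: "B = b2 * (b1 * b3)" and B3: "B = b3 * (b1 * b2)" by (simp_all add: B_def)
  have p: "b2 * b3 > 0" "b1 * b3 > 0" "b1 * b2 > 0" using b by simp_all
  obtain F where "f = puiseux_of_fps B F"
    by (rule puiseux_denominatorE[OF B, of f])
      (use 1 nat_frac_mult_denominator(1)[OF _ b(1) p(1)] in \<open>unfold B_def, blast\<close>)
  moreover obtain G where "g = puiseux_of_fps B G"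
    by (rule puiseux_denominatorE[OF B, of g])
      (use 2 nat_frac_mult_denominator(1)[OF _ b(2) p(2)] in \<open>unfold B2, blast\<close>)
  moreover obtain H where "h = puiseux_of_fps B H"
    by (rule puiseux_denominatorE[OF B, of h])
      (use 3 nat_frac_mult_denominator(1)[OF _ b(3) p(3)] in \<open>unfold B3, blast\<close>)
  ultimately show ?thesis using that B by blast
qed

lemma puiseux_common2:
  obtains b F G where "b > 0" "f = puiseux_of_fps b F" "g = puiseux_of_fps b G"
  using puiseux_common3[of f g g] by metis

definition puiseux_conv :: "(rat \<Rightarrow> rat) \<Rightarrow> (rat \<Rightarrow> rat) \<Rightarrow> rat \<Rightarrow> rat" where
  "puiseux_conv f g \<gamma> = (\<Sum>\<alpha> | f \<alpha> \<noteq> 0 \<and> g (\<gamma> - \<alpha>) \<noteq> 0. f \<alpha> * g (\<gamma> - \<alpha>))"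
  \<comment> \<open>the Cauchy product; the index set is finite by \<open>finite_puiseux_conv\<close> below\<close>

lemma finite_puiseux_conv_aux:
  fixes b :: nat and f g :: "rat \<Rightarrow> rat"
  assumes b: "b > 0"
    and f: "\<And>\<alpha>. f \<alpha> \<noteq> 0 \<Longrightarrow> \<exists>n::nat. \<alpha> = of_nat n / of_nat b"
    and g: "\<And>\<alpha>. g \<alpha> \<noteq> 0 \<Longrightarrow> \<exists>n::nat. \<alpha> = of_nat n / of_nat b"
    and fg: "f \<alpha> \<noteq> 0" "g (\<gamma> - \<alpha>) \<noteq> 0"
  shows "\<exists>i n::nat. i \<le> n \<and> \<alpha> = of_nat i / of_nat b \<and> \<gamma> = of_nat n / of_nat b"
proof -
  obtain i j :: nat where i: "\<alpha> = of_nat i / of_nat b" and j: "\<gamma> - \<alpha> = of_nat j / of_nat b"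
    using f[OF fg(1)] g[OF fg(2)] by blast
  have "\<gamma> = of_nat (i + j) / of_nat b" using i j b by (simp add: field_simps)
  then show ?thesis using i by (intro exI[of _ i] exI[of _ "i + j"]) auto
qed

lemma finite_puiseux_conv:
  "finite {\<alpha>. puiseux_coeff f \<alpha> \<noteq> 0 \<and> puiseux_coeff g (\<gamma> - \<alpha>) \<noteq> 0}"
proof -
  obtain b F G where b: "b > 0" and fg: "f = puiseux_of_fps b F" "g = puiseux_of_fps b G"
    by (rule puiseux_common2)
  let ?S = "{\<alpha>. puiseux_coeff f \<alpha> \<noteq> 0 \<and> puiseux_coeff g (\<gamma> - \<alpha>) \<noteq> 0}"
  have "?S \<subseteq> (\<lambda>i. of_nat i / of_nat b) ` {..nat \<lfloor>\<gamma> * of_nat b\<rfloor>}"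
  proof
    fix \<alpha> assume "\<alpha> \<in> ?S"
    then obtain i n :: nat where "i \<le> n" "\<alpha> = of_nat i / of_nat b" "\<gamma> = of_nat n / of_nat b"
      using finite_puiseux_conv_aux[OF b, of "puiseux_coeff f" "puiseux_coeff g" \<alpha> \<gamma>]
        coeff_puiseux_of_fps_nonzeroD fg by auto
    then show "\<alpha> \<in> (\<lambda>i. of_nat i / of_nat b) ` {..nat \<lfloor>\<gamma> * of_nat b\<rfloor>}"
      using b by auto
  qed
  then show ?thesis by (rule finite_subset) auto
qed

lemma puiseux_conv_fps:
  assumes b: "b > 0"
  shows "puiseux_conv (puiseux_coeff (puiseux_of_fps b F)) (puiseux_coeff (puiseux_of_fps b G))
    = puiseux_coeff (puiseux_of_fps b (F * G))"
proof
  fix \<gamma> :: rat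
  let ?f = "puiseux_coeff (puiseux_of_fps b F)" and ?g = "puiseux_coeff (puiseux_of_fps b G)"
  let ?S = "{\<alpha>. ?f \<alpha> \<noteq> 0 \<and> ?g (\<gamma> - \<alpha>) \<noteq> 0}"
  have aux: "\<exists>i n::nat. i \<le> n \<and> \<alpha> = of_nat i / of_nat b \<and> \<gamma> = of_nat n / of_nat b"
    if "\<alpha> \<in> ?S" for \<alpha>
    using that finite_puiseux_conv_aux[OF b, of ?f ?g \<alpha> \<gamma>] coeff_puiseux_of_fps_nonzeroD by blast
  show "puiseux_conv ?f ?g \<gamma> = puiseux_coeff (puiseux_of_fps b (F * G)) \<gamma>"
  proof (cases "\<exists>n::nat. \<gamma> = of_nat n / of_nat b")
    case True
    then obtain n :: nat where n: "\<gamma> = of_nat n / of_nat b" by blast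
    let ?h = "\<lambda>i::nat. of_nat i / of_nat b :: rat"
    have sub: "?S \<subseteq> ?h ` {0..n}"
    proof
      fix \<alpha> assume "\<alpha> \<in> ?S"
      then obtain i m :: nat where "i \<le> m" "\<alpha> = ?h i" "\<gamma> = ?h m"
        using aux[of \<alpha>] by blast
      then show "\<alpha> \<in> ?h ` {0..n}" using n b by auto
    qed
    have inj: "inj_on ?h {0..n}" using b by (auto simp: inj_on_def)
    have "puiseux_conv ?f ?g \<gamma> = (\<Sum>\<alpha>\<in>?h ` {0..n}. ?f \<alpha> * ?g (\<gamma> - \<alpha>))"
      unfolding puiseux_conv_def by (rule sum.mono_neutral_left) (use sub in auto)
    also have "\<dots> = (\<Sum>i=0..n. ?f (?h i) * ?g (\<gamma> - ?h i))"
      by (simp add: sum.reindex[OF inj])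
    also have "\<dots> = (\<Sum>i=0..n. fps_nth F i * fps_nth G (n - i))"
    proof (rule sum.cong)
      fix i assume "i \<in> {0..n}"
      then have "\<gamma> - ?h i = ?h (n - i)" using n by (simp add: of_nat_diff diff_divide_distrib)
      then show "?f (?h i) * ?g (\<gamma> - ?h i) = fps_nth F i * fps_nth G (n - i)"
        using b by (simp add: coeff_puiseux_of_fps)
    qed simp
    also have "\<dots> = puiseux_coeff (puiseux_of_fps b (F * G)) \<gamma>"
      using b n by (simp add: coeff_puiseux_of_fps fps_mult_nth)
    finally show ?thesis .
  next
    case False
    then have "?S = {}" using aux by blast
    then have "puiseux_conv ?f ?g \<gamma> = 0" unfolding puiseux_conv_def by (simp only: sum.empty)
    then show ?thesis using False by (simp add: coeff_puiseux_of_fps_eq_0)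
  qed
qed

instantiation puiseux :: comm_ring_1
begin

lift_definition zero_puiseux :: puiseux is "\<lambda>_. 0"
  by (rule exI[of _ 1]) auto

lift_definition one_puiseux :: puiseux is "\<lambda>\<alpha>. if \<alpha> = 0 then 1 else 0"
  by (rule exI[of _ 1]) (auto intro: exI[of _ 0])

lift_definition uminus_puiseux :: "puiseux \<Rightarrow> puiseux" is "\<lambda>f \<alpha>. - f \<alpha>"
  by auto

lift_definition plus_puiseux :: "puiseux \<Rightarrow> puiseux \<Rightarrow> puiseux" is "\<lambda>f g \<alpha>. f \<alpha> + g \<alpha>"
proof -
  fix f g :: "rat \<Rightarrow> rat"
  assume "\<exists>b::nat. b > 0 \<and> (\<forall>\<alpha>. f \<alpha> \<noteq> 0 \<longrightarrow> (\<exists>n::nat. \<alpha> = of_nat n / of_nat b))"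
    and "\<exists>b::nat. b > 0 \<and> (\<forall>\<alpha>. g \<alpha> \<noteq> 0 \<longrightarrow> (\<exists>n::nat. \<alpha> = of_nat n / of_nat b))"
  then obtain b c :: nat where bc: "b > 0" "c > 0"
    and f: "\<And>\<alpha>. f \<alpha> \<noteq> 0 \<Longrightarrow> \<exists>n::nat. \<alpha> = of_nat n / of_nat b"
    and g: "\<And>\<alpha>. g \<alpha> \<noteq> 0 \<Longrightarrow> \<exists>n::nat. \<alpha> = of_nat n / of_nat c" by blast
  have "\<exists>n::nat. \<alpha> = of_nat n / of_nat (b * c)" if "f \<alpha> + g \<alpha> \<noteq> 0" for \<alpha>
  proof -
    have "f \<alpha> \<noteq> 0 \<or> g \<alpha> \<noteq> 0" using that by auto
    then show ?thesis
      using f g nat_frac_mult_denominator(1)[OF _ bc] nat_frac_mult_denominator(2)[OF _ bc(2,1)]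
      by blast
  qed
  then show "\<exists>b::nat. b > 0 \<and> (\<forall>\<alpha>. f \<alpha> + g \<alpha> \<noteq> 0 \<longrightarrow> (\<exists>n::nat. \<alpha> = of_nat n / of_nat b))"
    using bc by (intro exI[of _ "b * c"]) auto
qed

definition minus_puiseux :: "puiseux \<Rightarrow> puiseux \<Rightarrow> puiseux" where
  "minus_puiseux f g = f + (- g)"

lift_definition times_puiseux :: "puiseux \<Rightarrow> puiseux \<Rightarrow> puiseux" is puiseux_conv
proof -
  fix f g :: "rat \<Rightarrow> rat"
  assume f: "\<exists>b::nat. b > 0 \<and> (\<forall>\<alpha>. f \<alpha> \<noteq> 0 \<longrightarrow> (\<exists>n::nat. \<alpha> = of_nat n / of_nat b))"
    and g: "\<exists>b::nat. b > 0 \<and> (\<forall>\<alpha>. g \<alpha> \<noteq> 0 \<longrightarrow> (\<exists>n::nat. \<alpha> = of_nat n / of_nat b))"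
  obtain b F G where b: "b > 0"
    and "Abs_puiseux f = puiseux_of_fps b F" "Abs_puiseux g = puiseux_of_fps b G"
    by (rule puiseux_common2)
  moreover have "puiseux_coeff (Abs_puiseux f) = f" "puiseux_coeff (Abs_puiseux g) = g"
    using f g by (simp_all only: Abs_puiseux_inverse mem_Collect_eq)
  ultimately have "f = puiseux_coeff (puiseux_of_fps b F)" "g = puiseux_coeff (puiseux_of_fps b G)"
    by simp_all
  then have eq: "puiseux_conv f g = puiseux_coeff (puiseux_of_fps b (F * G))"
    using puiseux_conv_fps[OF b] by simp
  show "\<exists>b::nat. b > 0 \<and>
      (\<forall>\<alpha>. puiseux_conv f g \<alpha> \<noteq> 0 \<longrightarrow> (\<exists>n::nat. \<alpha> = of_nat n / of_nat b))"
    unfolding eq by (rule puiseux_denominator_ex)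
qed

lemma puiseux_of_fps_mult:
  "b > 0 \<Longrightarrow> puiseux_of_fps b F * puiseux_of_fps b G = puiseux_of_fps b (F * G)"
  by (rule puiseux_eqI) (simp add: times_puiseux.rep_eq puiseux_conv_fps)

lemma puiseux_of_fps_add:
  "b > 0 \<Longrightarrow> puiseux_of_fps b F + puiseux_of_fps b G = puiseux_of_fps b (F + G)"
  by (rule puiseux_of_fps_eqI)
    (auto simp: plus_puiseux.rep_eq coeff_puiseux_of_fps coeff_puiseux_of_fps_eq_0)

lemma puiseux_of_fps_1: "b > 0 \<Longrightarrow> 1 = puiseux_of_fps b 1"
  by (rule puiseux_of_fps_eqI) (auto simp: one_puiseux.rep_eq)

instance
proof
  fix f g h :: puiseux
  obtain b F G H where b: "b > 0"
    and *: "f = puiseux_of_fps b F" "g = puiseux_of_fps b G" "h = puiseux_of_fps b H"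
    by (rule puiseux_common3)
  show "f * g * h = f * (g * h)" "f * g = g * f" "(f + g) * h = f * h + g * h" "1 * f = f"
    using b by (simp_all add: * puiseux_of_fps_1[OF b] puiseux_of_fps_mult puiseux_of_fps_add
        algebra_simps)
  show "f + g + h = f + (g + h)" "f + g = g + f" "0 + f = f" "- f + f = 0"
    by (transfer; simp add: algebra_simps)+
  show "f - g = f + - g" by (rule minus_puiseux_def)
  show "(0::puiseux) \<noteq> 1" by transfer (metis zero_neq_one)
qed

end

lemma puiseux_coeff_add: "puiseux_coeff (f + g) \<alpha> = puiseux_coeff f \<alpha> + puiseux_coeff g \<alpha>"
  by transfer simp

lemma puiseux_coeff_uminus: "puiseux_coeff (- f) \<alpha> = - puiseux_coeff f \<alpha>"
  by transfer simp

lemma puiseux_coeff_diff: "puiseux_coeff (f - g) \<alpha> = puiseux_coeff f \<alpha> - puiseux_coeff g \<alpha>"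
  unfolding minus_puiseux_def
  by (simp only: puiseux_coeff_add puiseux_coeff_uminus diff_conv_add_uminus)

lemma puiseux_coeff_0: "puiseux_coeff 0 \<alpha> = 0"
  by transfer simp

lemma puiseux_coeff_1: "puiseux_coeff 1 \<alpha> = (if \<alpha> = 0 then 1 else 0)"
  by transfer simp

lemma puiseux_coeff_mult:
  "puiseux_coeff (f * g) \<gamma> =
    (\<Sum>\<alpha> | puiseux_coeff f \<alpha> \<noteq> 0 \<and> puiseux_coeff g (\<gamma> - \<alpha>) \<noteq> 0.
      puiseux_coeff f \<alpha> * puiseux_coeff g (\<gamma> - \<alpha>))"
  by (simp add: times_puiseux.rep_eq puiseux_conv_def)

text \<open>As usual for rings with partial division, \<open>inverse f = 0\<close> if \<open>f\<close> is not a unit.\<close>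

instantiation puiseux :: inverse
begin

definition inverse_puiseux :: "puiseux \<Rightarrow> puiseux" where
  "inverse_puiseux f = (if \<exists>g. f * g = 1 then THE g. f * g = 1 else 0)"

definition divide_puiseux :: "puiseux \<Rightarrow> puiseux \<Rightarrow> puiseux" where
  "divide_puiseux f g = f * inverse g"

instance ..

end

lemma puiseux_inverse_unique: "f * g = 1 \<Longrightarrow> inverse f = (g :: puiseux)"
proof -
  assume g: "f * g = 1"
  have "h = g" if "f * h = 1" for h
  proof -
    have "h = (f * g) * h" using g by simp
    also have "\<dots> = (f * h) * g" by (simp only: mult_ac)
    finally show ?thesis using that by simp
  qed
  then have "(THE h. f * h = 1) = g" by (intro the_equality g)
  then show ?thesis using g by (auto simp: inverse_puiseux_def)
qed

lemma puiseux_mult_inverse: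
  assumes "puiseux_coeff f 0 \<noteq> 0"
  shows "f * inverse f = 1"
proof -
  obtain b F G where b: "b > 0" and f: "f = puiseux_of_fps b F"
    by (rule puiseux_common2)
  have "fps_nth F 0 \<noteq> 0" using assms coeff_puiseux_of_fps[OF b, of F 0] f by simp
  then have "f * puiseux_of_fps b (inverse F) = 1"
    using b by (simp add: f puiseux_of_fps_mult puiseux_of_fps_1[OF b] inverse_mult_eq_1')
  then show ?thesis using puiseux_inverse_unique by metis
qed

lemma puiseux_divide_mult_cancel:
  "puiseux_coeff g 0 \<noteq> 0 \<Longrightarrow> f / g * g = (f :: puiseux)"
  by (simp add: divide_puiseux_def mult.assoc mult.commute[of "inverse g" g]
      puiseux_mult_inverse)

section \<open>Integer trace, the order, and Gaussian binomials\<close>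

text \<open>The monomial $q^\alpha$; negative exponents do not occur in the ring and are sent to 0.\<close>

lift_definition qpow :: "rat \<Rightarrow> puiseux" is
  "\<lambda>\<alpha> \<beta>. if \<beta> = \<alpha> \<and> \<alpha> \<ge> 0 then 1 else 0"
proof -
  fix \<alpha> :: rat
  have "\<exists>b::nat. b > 0 \<and> (\<alpha> \<ge> 0 \<longrightarrow> (\<exists>n::nat. \<alpha> = of_nat n / of_nat b))"
  proof -
    obtain k l :: int where kl: "quotient_of \<alpha> = (k, l)" by (cases "quotient_of \<alpha>")
    have l: "l > 0" and \<alpha>: "\<alpha> = of_int k / of_int l"
      using quotient_of_denom_pos[OF kl] quotient_of_div[OF kl] by auto
    have "\<alpha> = of_nat (nat k) / of_nat (nat l)" if "\<alpha> \<ge> 0"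
      using that l \<alpha> by (simp add: zero_le_divide_iff of_nat_nat)
    then show ?thesis using l by (intro exI[of _ "nat l"]) auto
  qed
  then show "\<exists>b::nat. b > 0 \<and>
      (\<forall>\<beta>. (if \<beta> = \<alpha> \<and> \<alpha> \<ge> 0 then 1 else 0 :: rat) \<noteq> 0 \<longrightarrow> (\<exists>n::nat. \<beta> = of_nat n / of_nat b))"
    by auto
qed

definition integer_trace :: "puiseux \<Rightarrow> rat fps" where
  "integer_trace A = Abs_fps (\<lambda>d. puiseux_coeff A (of_nat d))"

definition q_ge :: "puiseux \<Rightarrow> puiseux \<Rightarrow> bool"  (infix \<open>\<ge>\<^sub>q\<close> 50) where
  "F \<ge>\<^sub>q G \<longleftrightarrow> (\<forall>d. fps_nth (integer_trace (F - G)) d \<ge> 0)"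

text \<open>
  \<open>gauss_binomial r k\<close> is $\left[{r+k \atop k}\right]_q$: the first argument is \<open>r\<close>, not the upper
  entry \<open>r + k\<close>.
\<close>

definition gauss_binomial :: "rat \<Rightarrow> nat \<Rightarrow> puiseux" where
  "gauss_binomial r k = (\<Prod>i=1..k. 1 - qpow (r + of_nat i)) / (\<Prod>i=1..k. 1 - qpow (of_nat i))"

lemma puiseux_coeff_mult_0:
  "puiseux_coeff (f * g) 0 = puiseux_coeff f 0 * puiseux_coeff g 0"
proof -
  obtain b F G where b: "b > 0" and fg: "f = puiseux_of_fps b F" "g = puiseux_of_fps b G"
    by (rule puiseux_common2)
  show ?thesis
    using coeff_puiseux_of_fps[OF b, of F 0] coeff_puiseux_of_fps[OF b, of G 0]
      coeff_puiseux_of_fps[OF b, of "F * G" 0] b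
    by (simp add: fg puiseux_of_fps_mult)
qed

text \<open>The quotient defining \<open>gauss_binomial\<close> is a genuine one, the denominator being a unit.\<close>

lemma gauss_binomial_mult_denominator:
  "gauss_binomial r k * (\<Prod>i=1..k. 1 - qpow (of_nat i)) = (\<Prod>i=1..k. 1 - qpow (r + of_nat i))"
proof -
  have "puiseux_coeff (\<Prod>i=1..m. 1 - qpow (of_nat i)) 0 = 1" for m
    by (induction m)
      (auto simp: puiseux_coeff_mult_0 puiseux_coeff_1 puiseux_coeff_diff qpow.rep_eq
        simp flip: of_nat_Suc)
  then show ?thesis
    unfolding gauss_binomial_def by (intro puiseux_divide_mult_cancel) simp
qed

end

theory Submission
  imports Defs
begin

text \<open>
  Multiplication by a power series in \<open>q\<close> commutes with the integer trace
  (\<open>integer_trace_mult\<close>).  The denominator $D_k = (1-q)\cdots(1-q^k)$ is such a series, so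
  only the numerator has to be traced.  Expanded in powers of $q^r$, it gives
  $D_3 T = 1 - t_1 (q+q^2+q^3) + t_2 (q^3+q^4+q^5) - t_3 q^6$ for the trace \<open>T\<close> of the
  binomial with $k = 3$, where $t_j$ is the trace of $q^{jr}$: it is
  $q^{jr}$ if $jr$ is an integer and $0$
  otherwise.  The expansions for $k = 1, 2$ have the same shape.

  At $r = 1/2$ only $t_2 = q$ survives.  In the difference of the two sides the terms
  with $t_1$ and $t_3$ enter with a positive sign.  For $k \ge 2$ there remains a multiple of
  $q^4 - t_2 q^3$ by a series with nonnegative coefficients, and $q^4 - t_2 q^3$ has
  nonnegative coefficients after division by $1-q$: as $r > 0$,
  $2r$ is at least $1$ if it is an integer, so the negative term cannot come before $q^4$
  (\<open>quadratic_term_nonneg\<close>).  One factor $1-q$ of the denominator thus suffices to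
  absorb the only negative term, and the other factors have nonnegative inverses.  For $k = 3$
  the term is multiplied by $1+q+q^2$, which turns $1/(1-q^3)$ into $1/(1-q)$.
\<close>

section \<open>Power series with nonnegative coefficients\<close>

definition fps_nonneg :: "rat fps \<Rightarrow> bool" where
  "fps_nonneg F \<longleftrightarrow> (\<forall>n. fps_nth F n \<ge> 0)"

lemma fps_nonneg_add: "fps_nonneg F \<Longrightarrow> fps_nonneg G \<Longrightarrow> fps_nonneg (F + G)"
  by (simp add: fps_nonneg_def)

lemma fps_nonneg_mult: "fps_nonneg F \<Longrightarrow> fps_nonneg G \<Longrightarrow> fps_nonneg (F * G)"
  by (simp add: fps_nonneg_def fps_mult_nth sum_nonneg)

lemma fps_nonneg_X_power: "fps_nonneg (fps_X ^ n)"
  by (simp add: fps_nonneg_def)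

lemma fps_nonneg_sum: "(\<And>i. i \<in> A \<Longrightarrow> fps_nonneg (F i)) \<Longrightarrow> fps_nonneg (sum F A)"
  by (simp add: fps_nonneg_def fps_sum_nth sum_nonneg)

lemma one_minus_X_power_inverse:
  "m > 0 \<Longrightarrow> (1 - fps_X ^ m) * inverse (1 - fps_X ^ m :: rat fps) = 1"
  by (simp add: inverse_mult_eq_1')

text \<open>The coefficients $c_n$ of $1/(1-q^m)$ satisfy $c_n = c_{n-m}$ for $n > 0$,
  where $c_j = 0$ for $j < 0$.\<close>

lemma fps_nonneg_inverse_one_minus_X_power:
  assumes "m > 0"
  shows "fps_nonneg (inverse (1 - fps_X ^ m))"
  unfolding fps_nonneg_def
proof
  fix n
  define I where "I = inverse (1 - fps_X ^ m :: rat fps)"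
  have I: "I = 1 + fps_X ^ m * I"
    using one_minus_X_power_inverse[OF assms] by (simp add: I_def algebra_simps)
  show "fps_nth I n \<ge> 0"
  proof (induction n rule: less_induct)
    case (less n)
    have "fps_nth I n = fps_nth (1 + fps_X ^ m * I) n"
      using I by simp
    then show ?case
      using less[of "n - m"] assms by (auto simp: fps_X_power_mult_nth)
  qed
qed

section \<open>The integer trace\<close>

lemma integer_trace_add: "integer_trace (A + B) = integer_trace A + integer_trace B"
  by (rule fps_ext) (simp add: integer_trace_def puiseux_coeff_add)

lemma integer_trace_diff: "integer_trace (A - B) = integer_trace A - integer_trace B"
  by (rule fps_ext) (simp add: integer_trace_def puiseux_coeff_diff)

lemma q_ge_iff: "F \<ge>\<^sub>q G \<longleftrightarrow> fps_nonneg (integer_trace F - integer_trace G)"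
  by (simp add: q_ge_def fps_nonneg_def integer_trace_diff)

text \<open>
  \<open>puiseux_of_fps 1\<close> is the embedding of $\mathbb{Q}[[q]]$.  The trace is linear over its image:
  if $\alpha + i$ and $i$ are integers then so is $\alpha$, hence terms with a nonintegral
  exponent contribute nothing to the integral part of the product.
\<close>

lemma integer_trace_mult:
  "integer_trace (A * puiseux_of_fps 1 F) = integer_trace A * F"
proof (rule fps_ext)
  fix d
  let ?f = "puiseux_coeff (puiseux_of_fps 1 F)" and ?a = "puiseux_coeff A"
  have f: "?f (of_nat i) = fps_nth F i" for i
    using coeff_puiseux_of_fps[of 1 F i] by simp
  have sub: "{\<alpha>. ?f \<alpha> \<noteq> 0 \<and> ?a (of_nat d - \<alpha>) \<noteq> 0} \<subseteq> of_nat ` {0..d}"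
  proof
    fix \<alpha> assume *: "\<alpha> \<in> {\<alpha>. ?f \<alpha> \<noteq> 0 \<and> ?a (of_nat d - \<alpha>) \<noteq> 0}"
    then obtain i :: nat where i: "\<alpha> = of_nat i"
      using coeff_puiseux_of_fps_nonzeroD[of 1 F \<alpha>] by auto
    obtain b n :: nat where "of_nat d - \<alpha> = of_nat n / of_nat b"
      using * puiseux_denominator_ex[of A] by blast
    then have "\<alpha> \<le> of_nat d"
      by (metis diff_ge_0_iff_ge divide_nonneg_nonneg of_nat_0_le_iff)
    then show "\<alpha> \<in> of_nat ` {0..d}" using i by auto
  qed
  have "fps_nth (integer_trace (A * puiseux_of_fps 1 F)) d
      = (\<Sum>\<alpha>\<in>of_nat ` {0..d}. ?f \<alpha> * ?a (of_nat d - \<alpha>))"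
    unfolding integer_trace_def fps_nth_Abs_fps mult.commute[of A] puiseux_coeff_mult
    by (rule sum.mono_neutral_left) (use sub in auto)
  also have "\<dots> = (\<Sum>i=0..d. fps_nth F i * ?a (of_nat (d - i)))"
    by (simp add: sum.reindex inj_on_def f of_nat_diff del: One_nat_def)
  also have "\<dots> = fps_nth (F * integer_trace A) d"
    by (simp add: fps_mult_nth integer_trace_def)
  finally show "fps_nth (integer_trace (A * puiseux_of_fps 1 F)) d
      = fps_nth (integer_trace A * F) d"
    by (simp add: mult.commute)
qed

lemma integer_trace_of_fps: "integer_trace (puiseux_of_fps 1 F) = F"
  using coeff_puiseux_of_fps[of 1 F] by (intro fps_ext) (simp add: integer_trace_def)

lemma integer_trace_qpow_of_nat: "integer_trace (qpow (of_nat n)) = fps_X ^ n"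
  by (rule fps_ext) (simp add: integer_trace_def qpow.rep_eq)

lemma integer_trace_qpow_nonintegral:
  assumes "\<And>n::nat. \<alpha> \<noteq> of_nat n"
  shows "integer_trace (qpow \<alpha>) = 0"
proof (rule fps_ext)
  fix n
  show "fps_nth (integer_trace (qpow \<alpha>)) n = fps_nth 0 n"
    using assms[of n] by (auto simp: integer_trace_def qpow.rep_eq)
qed

lemma fps_nonneg_integer_trace_qpow: "fps_nonneg (integer_trace (qpow \<alpha>))"
  by (simp add: fps_nonneg_def integer_trace_def qpow.rep_eq)

section \<open>Traces of Gaussian binomials\<close>

lemma puiseux_of_fps_diff:
  "b > 0 \<Longrightarrow> puiseux_of_fps b F - puiseux_of_fps b G = puiseux_of_fps b (F - G)"
  using puiseux_of_fps_add[of b "F - G" G] by (simp add: algebra_simps)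

lemma qpow_add:
  assumes "a \<ge> 0" "b \<ge> 0"
  shows "qpow (a + b) = qpow a * qpow b"
proof (rule puiseux_eqI)
  fix \<gamma>
  have "{\<alpha>. puiseux_coeff (qpow a) \<alpha> \<noteq> 0 \<and> puiseux_coeff (qpow b) (\<gamma> - \<alpha>) \<noteq> 0}
      = (if \<gamma> = a + b then {a} else {})"
    using assms by (auto simp: qpow.rep_eq)
  then show "puiseux_coeff (qpow (a + b)) \<gamma> = puiseux_coeff (qpow a * qpow b) \<gamma>"
    using assms by (simp add: puiseux_coeff_mult qpow.rep_eq)
qed

lemma qpow_of_nat: "qpow (of_nat n) = puiseux_of_fps 1 (fps_X ^ n)"
  by (rule puiseux_of_fps_eqI) (auto simp: qpow.rep_eq)

lemma gauss_denominator:
  "(\<Prod>i=1..k. 1 - qpow (of_nat i)) = puiseux_of_fps 1 (\<Prod>i=1..k. 1 - fps_X ^ i)"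
proof (induction k)
  case (Suc k)
  have split: "(\<Prod>i=1..Suc k. f i) = f (Suc k) * (\<Prod>i=1..k. f i)"
    for f :: "nat \<Rightarrow> 'a::comm_monoid_mult"
    by (rule prod.nat_ivl_Suc') simp
  have "1 - qpow (of_nat (Suc k)) = puiseux_of_fps 1 (1 - fps_X ^ Suc k)"
    by (simp only: qpow_of_nat puiseux_of_fps_1[of 1] puiseux_of_fps_diff zero_less_one)
  then show ?case
    using Suc.IH by (simp only: split puiseux_of_fps_mult zero_less_one)
qed (simp add: puiseux_of_fps_1[of 1])

lemma integer_trace_gauss_mult_denominator:
  "integer_trace (gauss_binomial r k) * (\<Prod>i=1..k. 1 - fps_X ^ i)
    = integer_trace (\<Prod>i=1..k. 1 - qpow (r + of_nat i))"
  using gauss_binomial_mult_denominator[of r k]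
  by (simp only: gauss_denominator flip: integer_trace_mult)

lemma gauss_numerator:
  assumes "r \<ge> 0"
  shows "(\<Prod>i=1..k. 1 - qpow (r + of_nat i))
    = (\<Prod>i=1..k. 1 - qpow r * puiseux_of_fps 1 (fps_X ^ i))"
  using assms by (simp add: qpow_add qpow_of_nat)

text \<open>
  The common shape of the expansions for $k \le 3$ as polynomials in $q^r$; the lemma
  moves the trace past coefficients in
  $\mathbb{Q}[[q]]$ and leaves only the traces of $q^{jr}$.
\<close>

lemma integer_trace_cubic:
  assumes "r \<ge> 0"
  shows "integer_trace (1 - qpow r * puiseux_of_fps 1 F + qpow r ^ 2 * puiseux_of_fps 1 G
      - qpow r ^ 3 * puiseux_of_fps 1 H)
    = 1 - integer_trace (qpow r) * F + integer_trace (qpow (2 * r)) * G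
      - integer_trace (qpow (3 * r)) * H"
proof -
  have 2: "qpow r ^ 2 = qpow (2 * r)"
    using qpow_add[OF assms assms] by (simp add: power2_eq_square)
  have "qpow r ^ 3 = qpow (r + 2 * r)"
    using qpow_add[of r "2 * r"] assms 2 by (simp add: power3_eq_cube power2_eq_square)
  then have 3: "qpow r ^ 3 = qpow (3 * r)" by simp
  have 1: "integer_trace 1 = 1"
    using integer_trace_of_fps[of 1] puiseux_of_fps_1[of 1] by simp
  show ?thesis
    by (simp only: 1 2 3 integer_trace_add integer_trace_diff integer_trace_mult)
qed

context
  fixes r :: rat
  assumes r: "r \<ge> 0"
begin

lemma integer_trace_gauss_1:
  "integer_trace (gauss_binomial r 1) * (1 - fps_X)
    = 1 - integer_trace (qpow r) * fps_X"
proof -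
  have "(\<Prod>i=1..1. 1 - qpow r * puiseux_of_fps 1 (fps_X ^ i))
    = 1 - qpow r * puiseux_of_fps 1 fps_X + qpow r ^ 2 * puiseux_of_fps 1 0
      - qpow r ^ 3 * puiseux_of_fps 1 0"
  proof -
    have "puiseux_of_fps 1 0 = 0"
      using puiseux_of_fps_diff[of 1 0 0] by simp
    then show ?thesis by simp
  qed
  then show ?thesis
    using integer_trace_gauss_mult_denominator[of r 1] gauss_numerator[OF r, of 1]
      integer_trace_cubic[OF r, of fps_X 0 0]
    by simp
qed

lemma integer_trace_gauss_2:
  "integer_trace (gauss_binomial r 2) * ((1 - fps_X) * (1 - fps_X ^ 2))
    = 1 - integer_trace (qpow r) * (fps_X + fps_X ^ 2)
      + integer_trace (qpow (2 * r)) * fps_X ^ 3"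
proof -
  define E :: "rat fps \<Rightarrow> puiseux" where "E = puiseux_of_fps 1"
  have E: "E F + E G = E (F + G)" "E F * E G = E (F * G)" "E 0 = 0" for F G
    using puiseux_of_fps_diff[of 1 0 0]
    by (simp_all add: E_def puiseux_of_fps_add puiseux_of_fps_mult)
  have "(\<Prod>i=1..2. 1 - qpow r * E (fps_X ^ i))
    = (1 - qpow r * E fps_X) * (1 - qpow r * E (fps_X ^ 2))"
    by (simp add: numeral_2_eq_2)
  also have "\<dots> = 1 - qpow r * (E fps_X + E (fps_X ^ 2))
      + qpow r ^ 2 * (E fps_X * E (fps_X ^ 2))"
    by (simp add: algebra_simps power2_eq_square)
  also have "\<dots> = 1 - qpow r * E (fps_X + fps_X ^ 2) + qpow r ^ 2 * E (fps_X ^ 3)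
      - qpow r ^ 3 * E 0"
    by (simp add: E eval_nat_numeral)
  finally show ?thesis
    using integer_trace_gauss_mult_denominator[of r 2] gauss_numerator[OF r, of 2]
      integer_trace_cubic[OF r, of "fps_X + fps_X ^ 2" "fps_X ^ 3" 0]
    unfolding E_def by (simp add: numeral_2_eq_2)
qed

lemma integer_trace_gauss_3:
  "integer_trace (gauss_binomial r 3) * ((1 - fps_X) * (1 - fps_X ^ 2) * (1 - fps_X ^ 3))
    = 1 - integer_trace (qpow r) * (fps_X + fps_X ^ 2 + fps_X ^ 3)
      + integer_trace (qpow (2 * r)) * (fps_X ^ 3 + fps_X ^ 4 + fps_X ^ 5)
      - integer_trace (qpow (3 * r)) * fps_X ^ 6"
proof -
  define E :: "rat fps \<Rightarrow> puiseux" where "E = puiseux_of_fps 1"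
  have E: "E F + E G = E (F + G)" "E F * E G = E (F * G)" for F G
    by (simp_all add: E_def puiseux_of_fps_add puiseux_of_fps_mult)
  have prod3: "(\<Prod>i=1..3. f i) = f 1 * f 2 * f 3" for f :: "nat \<Rightarrow> 'a::comm_monoid_mult"
    by (simp add: eval_nat_numeral)
  have "(\<Prod>i=1..3. 1 - qpow r * E (fps_X ^ i))
    = (1 - qpow r * E fps_X) * (1 - qpow r * E (fps_X ^ 2)) * (1 - qpow r * E (fps_X ^ 3))"
    by (simp only: prod3 power_one_right)
  also have "\<dots> = 1 - qpow r * (E fps_X + E (fps_X ^ 2) + E (fps_X ^ 3))
      + qpow r ^ 2 * (E fps_X * E (fps_X ^ 2) + E fps_X * E (fps_X ^ 3)
          + E (fps_X ^ 2) * E (fps_X ^ 3))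
      - qpow r ^ 3 * (E fps_X * E (fps_X ^ 2) * E (fps_X ^ 3))"
    by (simp add: algebra_simps power2_eq_square power3_eq_cube)
  also have "\<dots> = 1 - qpow r * E (fps_X + fps_X ^ 2 + fps_X ^ 3)
      + qpow r ^ 2 * E (fps_X ^ 3 + fps_X ^ 4 + fps_X ^ 5) - qpow r ^ 3 * E (fps_X ^ 6)"
    unfolding E by (simp add: eval_nat_numeral algebra_simps)
  finally show ?thesis
    using integer_trace_gauss_mult_denominator[of r 3] gauss_numerator[OF r, of 3]
      integer_trace_cubic[OF r, of "fps_X + fps_X ^ 2 + fps_X ^ 3"
        "fps_X ^ 3 + fps_X ^ 4 + fps_X ^ 5" "fps_X ^ 6"]
    unfolding E_def by (simp only: prod3 power_one_right)
qed

end

section \<open>The comparison\<close>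

text \<open>
  The term $q^4$ comes from $r = 1/2$, the least positive \<open>r\<close> for which $2r$ is an
  integer.  Whenever $2r$ is an integer, the quotient is the polynomial
  $q^4 (1 + q + \dots + q^{2r-2})$, which is $0$ for $r = 1/2$.
\<close>

lemma quadratic_term_nonneg:
  assumes "r > 0"
  shows "fps_nonneg ((fps_X ^ 4 - integer_trace (qpow (2 * r)) * fps_X ^ 3) * inverse (1 - fps_X))"
proof (cases "\<exists>n::nat. 2 * r = of_nat n")
  case True
  then obtain n :: nat where n: "2 * r = of_nat n" by blast
  then obtain m where m: "n = Suc m" using assms by (cases n) auto
  have "integer_trace (qpow (2 * r)) = fps_X ^ Suc m"
    unfolding n m by (rule integer_trace_qpow_of_nat)
  then have "fps_X ^ 4 - integer_trace (qpow (2 * r)) * fps_X ^ 3 = fps_X ^ 4 * (1 - fps_X ^ m)"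
    by (simp add: algebra_simps eval_nat_numeral)
  also have "\<dots> = fps_X ^ 4 * (\<Sum>i<m. fps_X ^ i) * (1 - fps_X)"
    by (simp add: one_diff_power_eq mult_ac)
  finally have "(fps_X ^ 4 - integer_trace (qpow (2 * r)) * fps_X ^ 3) * inverse (1 - fps_X)
      = fps_X ^ 4 * (\<Sum>i<m. fps_X ^ i)"
    using one_minus_X_power_inverse[of 1] by (simp add: mult.assoc)
  then show ?thesis
    by (simp add: fps_nonneg_mult fps_nonneg_sum fps_nonneg_X_power)
next
  case False
  then show ?thesis
    using fps_nonneg_inverse_one_minus_X_power[of 1]
    by (simp add: integer_trace_qpow_nonintegral fps_nonneg_mult fps_nonneg_X_power)
qed

lemma integer_trace_qpow_half_multiples:
  "integer_trace (qpow (1/2)) = 0" "integer_trace (qpow 1) = fps_X"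
  "integer_trace (qpow (3/2)) = 0"
proof -
  have "1/2 \<noteq> (of_nat n :: rat)" "3/2 \<noteq> (of_nat n :: rat)" for n
  proof -
    have "2 * n \<noteq> 1" "2 * n \<noteq> 3" by presburger+
    then have "of_nat (2 * n) \<noteq> (of_nat 1 :: rat)" "of_nat (2 * n) \<noteq> (of_nat 3 :: rat)"
      by (simp_all only: of_nat_eq_iff not_False_eq_True)
    then show "1/2 \<noteq> (of_nat n :: rat)" "3/2 \<noteq> (of_nat n :: rat)" by auto
  qed
  then show "integer_trace (qpow (1/2)) = 0" "integer_trace (qpow (3/2)) = 0"
    by (simp_all only: integer_trace_qpow_nonintegral not_False_eq_True)
  show "integer_trace (qpow 1) = fps_X"
    using integer_trace_qpow_of_nat[of 1] by simp
qed

theorem proposition4p1: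
  fixes k :: nat and r :: rat
  assumes "k \<in> {1, 2, 3}" and "r > 0"
  shows "gauss_binomial (1/2) k \<ge>\<^sub>q gauss_binomial r k"
proof -
  define X :: "rat fps" where "X = fps_X"
  define t1 t2 t3 where "t1 = integer_trace (qpow r)" and "t2 = integer_trace (qpow (2 * r))"
    and "t3 = integer_trace (qpow (3 * r))"
  define I1 I2 I3 where "I1 = inverse (1 - X)" and "I2 = inverse (1 - X ^ 2)"
    and "I3 = inverse (1 - X ^ 3)"
  define \<Delta> where
    "\<Delta> = integer_trace (gauss_binomial (1/2) k) - integer_trace (gauss_binomial r k)"
  have t_nonneg: "fps_nonneg t1" "fps_nonneg t3"
    unfolding t1_def t3_def by (rule fps_nonneg_integer_trace_qpow)+
  have I: "(1 - X) * I1 = 1" "(1 - X ^ 2) * I2 = 1" "(1 - X ^ 3) * I3 = 1"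
    using one_minus_X_power_inverse[of 1] one_minus_X_power_inverse[of 2]
      one_minus_X_power_inverse[of 3]
    by (simp_all add: X_def I1_def I2_def I3_def)
  have I_nonneg: "fps_nonneg I1" "fps_nonneg I2" "fps_nonneg I3"
    using fps_nonneg_inverse_one_minus_X_power[of 1] fps_nonneg_inverse_one_minus_X_power[of 2]
      fps_nonneg_inverse_one_minus_X_power[of 3]
    by (simp_all add: X_def I1_def I2_def I3_def)
  have X_nonneg: "fps_nonneg X" "\<And>n. fps_nonneg (X ^ n)"
    using fps_nonneg_X_power[of 1] fps_nonneg_X_power by (simp_all add: X_def)
  have quadratic: "fps_nonneg ((X ^ 4 - t2 * X ^ 3) * I1)"
    using quadratic_term_nonneg[OF \<open>r > 0\<close>] by (simp add: X_def t2_def I1_def)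
  note nonneg = fps_nonneg_add fps_nonneg_mult t_nonneg I_nonneg X_nonneg quadratic
  have half: "2 * (1/2) = (1::rat)" "3 * (1/2) = (3/2::rat)" by simp_all
  have "r \<ge> 0" using \<open>r > 0\<close> by simp
  have "fps_nonneg \<Delta>"
  proof -
    consider "k = 1" | "k = 2" | "k = 3" using \<open>k \<in> {1, 2, 3}\<close> by blast
    then show ?thesis
    proof cases
      case 1
      have "\<Delta> * (1 - X) = t1 * X"
        using integer_trace_gauss_1[of "1/2"] integer_trace_gauss_1[OF \<open>r \<ge> 0\<close>]
        unfolding half integer_trace_qpow_half_multiples
        by (simp add: \<Delta>_def 1 X_def t1_def left_diff_distrib)
      then have "\<Delta> = t1 * X * I1" using I by algebra
      then show ?thesis by (simp add: nonneg)
    next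
      case 2
      have "\<Delta> * ((1 - X) * (1 - X ^ 2)) = X ^ 4 - t2 * X ^ 3 + t1 * (X + X ^ 2)"
        using integer_trace_gauss_2[of "1/2"] integer_trace_gauss_2[OF \<open>r \<ge> 0\<close>]
        unfolding half integer_trace_qpow_half_multiples
        by (simp add: \<Delta>_def 2 X_def t1_def t2_def left_diff_distrib flip: power_Suc)
      then have "\<Delta> = (X ^ 4 - t2 * X ^ 3) * I1 * I2 + t1 * (X + X ^ 2) * I1 * I2"
        using I by algebra
      then show ?thesis by (simp add: nonneg)
    next
      case 3
      have "\<Delta> * ((1 - X) * (1 - X ^ 2) * (1 - X ^ 3))
          = (1 + X + X ^ 2) * (X ^ 4 - t2 * X ^ 3) + t1 * (X + X ^ 2 + X ^ 3) + t3 * X ^ 6"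
      proof -
        have "\<Delta> * ((1 - X) * (1 - X ^ 2) * (1 - X ^ 3))
            = (1 + X * (X ^ 3 + X ^ 4 + X ^ 5))
              - (1 - t1 * (X + X ^ 2 + X ^ 3) + t2 * (X ^ 3 + X ^ 4 + X ^ 5) - t3 * X ^ 6)"
          using integer_trace_gauss_3[of "1/2"] integer_trace_gauss_3[OF \<open>r \<ge> 0\<close>]
          unfolding half integer_trace_qpow_half_multiples \<Delta>_def 3 left_diff_distrib
          by (simp add: X_def t1_def t2_def t3_def)
        then show ?thesis by algebra
      qed
      \<comment> \<open>the second factor $1/(1-q)$ below frees the quadratic term from $1/(1-q^3)$\<close>
      moreover have "(1 + X + X ^ 2) * I3 = I1"
        using I by algebra
      ultimately have "\<Delta> = (X ^ 4 - t2 * X ^ 3) * I1 * I1 * I2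
          + (t1 * (X + X ^ 2 + X ^ 3) + t3 * X ^ 6) * I1 * I2 * I3"
        using I by algebra
      then show ?thesis by (simp add: nonneg)
    qed
  qed
  then show ?thesis by (simp add: q_ge_iff \<Delta>_def)
qed

end
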